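(* Let $L$ be a constructive involutive division on $\mathbb{M}$ and let $U\subset\mathbb{M}$ be a set that is finitely generated with respect to $L$. Then the following algorithm InvolutiveCompletion, for any choices made in it, computes the uniquely defined minimal completion $\bar U$ of $U$, that is, an $L$-completion $\bar U$ of $U$ such that $\bar U\subseteq\tilde U$ for any other $L$-completion $\tilde U$ of $U$. Algorithm: Set $\tilde U:=U$. While there exist $u\in\tilde U$ and $x\in NM_L(u,\tilde U)$ such that $u\cdot x$ has no involutive divisors in $\tilde U$: choose any admissible monomial ordering $\sqsubset$ (the choice may differ from step to step) and such $u$ and $x$ with the lowest $u\cdot x$ with respect to $\sqsubset$, and set $\tilde U:=\tilde U\cup\{u\cdot x\}$. Return $\tilde U$.
   Context: $\mathbb{M}=\{x_1^{d_1}\cdots x_n^{d_n}\mid d_i\in\mathbb{Z}_{\ge 0}\}$. An admissible monomial ordering is a total ordering on $\mathbb{M}$, compatible with multiplication, in which $1$ is the smallest element. All monomial sets are finite. Involutive division: an involutive division $L$ on $\mathbb{M}$ assigns to any finite $U\subset\mathbb{M}$ and $u\in U$ a submonoid $L(u,U)$ of $\mathbb{M}$ such that: (a) if $w\in L(u,U)$ and $v\mid w$, then $v\in L(u,U)$; (b) if $u,v\in U$ and $uL(u,U)\cap vL(v,U)\neq\emptyset$, then $u\in vL(v,U)$ or $v\in uL(u,U)$; (c) if $v\in U$ and $v\in uL(u,U)$, then $L(v,U)\subseteq L(u,U)$; (d) if $V\subseteq U$, then $L(u,U)\subseteq L(u,V)$ for all $u\in V$. The set of variables lying in $L(u,U)$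 is $M_L(u,U)$ (multiplicative variables), and $NM_L(u,U)$ is the set of the remaining (nonmultiplicative) variables. For $u\in U$ write $u\mid_L w$ if $w\in uL(u,U)$; then $u$ is an involutive divisor of $w$ in $U$. The notation $u\cdot x$ with $x\in NM_L(u,U)$ denotes the product. Cones: $C(U)=\bigcup_{u\in U}u\mathbb{M}$ and $C_L(U)=\bigcup_{u\in U}uL(u,U)$. A set $U$ is $L$-involutive if $C(U)=C_L(U)$. An $L$-completion of $U$ is a (finite) $L$-involutive set $\tilde U\supseteq U$ with $C(\tilde U)=C(U)$. $U$ is finitely generated with respect to $L$ if it has a finite $L$-completion. Continuous: $L$ is continuous if for any finite $U\subset\mathbb{M}$ and any finite sequence $u_1,\dots,u_k$ of elements of $U$ such that for every $i<k$ there is $x_j\in NM_L(u_i,U)$ with $u_{i+1}\mid_L u_i\cdot x_j$, one has $u_i\ne u_j$ for $i\ne j$. Constructive: a continuous involutive division $L$ is constructive if for any finite $U\subset\mathbb{M}$, $u\in U$, $x_i\in NM_L(u,U)$ such that $u\cdot x_i$ has no involutive divisors in $U$ and such that every $v\in U$, $x_j\in NM_L(v,U)$ with $v\cdot x_j\mid u\cdot x_i$ and $v\cdot x_j\ne u\cdot x_i$ satisfy $v\cdot x_j\in C_L(U)$, the following holds: for all $w\in C_L(U)$, $u\cdot x_i\notin wL(w,U\cup\{w\})$. *)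

theory Defs
  imports "HOL-Library.Multiset"
begin

text \<open>
  The variables \<open>x\<^sub>1, \<dots>, x\<^sub>n\<close> are the elements of a finite type \<open>'x\<close>.  A monomial is the finite
  multiset of its variables: \<open>x\<^sub>1^d\<^sub>1 \<cdots> x\<^sub>n^d\<^sub>n\<close> contains \<open>x\<^sub>i\<close> exactly \<open>d\<^sub>i\<close> times.
  So multiset sum \<open>+\<close> is the product of monomials, \<open>{#}\<close> is the monomial \<open>1\<close>,
  \<open>add_mset x u\<close> is \<open>u \<cdot> x\<close>, and \<open>\<subseteq>#\<close> and \<open>\<subset>#\<close> are divisibility and proper divisibility.
\<close>

type_synonym 'x monom = "'x multiset"

text \<open>The value \<open>L u U\<close> is meaningful only for finite \<open>U\<close> and \<open>u \<in> U\<close>.\<close>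

type_synonym 'x division = "'x monom \<Rightarrow> 'x monom set \<Rightarrow> 'x monom set"

definition admissible_ordering :: "'x monom rel \<Rightarrow> bool" where
  "admissible_ordering r \<longleftrightarrow>
     linear_order r \<and>
     (\<forall>s t v. (s, t) \<in> r \<longrightarrow> (s + v, t + v) \<in> r) \<and>
     (\<forall>s. ({#}, s) \<in> r)"

definition submonoid_monom :: "'x monom set \<Rightarrow> bool" where
  "submonoid_monom S \<longleftrightarrow> {#} \<in> S \<and> (\<forall>v\<in>S. \<forall>w\<in>S. v + w \<in> S)"

text \<open>The set \<open>u L(u,U)\<close>.\<close>

definition inv_multiples :: "'x division \<Rightarrow> 'x monom \<Rightarrow> 'x monom set \<Rightarrow> 'x monom set" where
  "inv_multiples L u U = (+) u ` L u U"

definition inv_dvd :: "'x division \<Rightarrow> 'x monom set \<Rightarrow> 'x monom \<Rightarrow> 'x monom \<Rightarrow> bool" where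
  "inv_dvd L U u w \<longleftrightarrow> u \<in> U \<and> w \<in> inv_multiples L u U"

definition mult_vars :: "'x division \<Rightarrow> 'x monom \<Rightarrow> 'x monom set \<Rightarrow> 'x set" where
  "mult_vars L u U = {x. {#x#} \<in> L u U}"

definition nonmult_vars :: "'x division \<Rightarrow> 'x monom \<Rightarrow> 'x monom set \<Rightarrow> 'x set" where
  "nonmult_vars L u U = - mult_vars L u U"

definition cone :: "'x monom set \<Rightarrow> 'x monom set" where
  "cone U = (\<Union>u\<in>U. range ((+) u))"

definition inv_cone :: "'x division \<Rightarrow> 'x monom set \<Rightarrow> 'x monom set" where
  "inv_cone L U = (\<Union>u\<in>U. inv_multiples L u U)"

locale involutive_division =
  fixes L :: "'x::finite division"
  assumes submonoid:
      "\<lbrakk>finite U; u \<in> U\<rbrakk> \<Longrightarrow> submonoid_monom (L u U)"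
    and divisor_closed:
      "\<lbrakk>finite U; u \<in> U; w \<in> L u U; v \<subseteq># w\<rbrakk> \<Longrightarrow> v \<in> L u U"
    and cones_meet:
      "\<lbrakk>finite U; u \<in> U; v \<in> U; inv_multiples L u U \<inter> inv_multiples L v U \<noteq> {}\<rbrakk>
        \<Longrightarrow> u \<in> inv_multiples L v U \<or> v \<in> inv_multiples L u U"
    and cone_transitive:
      "\<lbrakk>finite U; u \<in> U; v \<in> U; v \<in> inv_multiples L u U\<rbrakk> \<Longrightarrow> L v U \<subseteq> L u U"
    and filter_axiom:
      "\<lbrakk>finite U; V \<subseteq> U; u \<in> V\<rbrakk> \<Longrightarrow> L u U \<subseteq> L u V"

locale continuous_division = involutive_division +
  assumes continuous:
    "\<lbrakk>finite U; set us \<subseteq> U;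
      \<And>i. Suc i < length us \<Longrightarrow>
        \<exists>x\<in>nonmult_vars L (us ! i) U. inv_dvd L U (us ! Suc i) (add_mset x (us ! i))\<rbrakk>
      \<Longrightarrow> distinct us"

locale constructive_division = continuous_division +
  assumes constructive:
    "\<lbrakk>finite U; u \<in> U; x \<in> nonmult_vars L u U;
      \<nexists>v. inv_dvd L U v (add_mset x u);
      \<And>v y. \<lbrakk>v \<in> U; y \<in> nonmult_vars L v U; add_mset y v \<subset># add_mset x u\<rbrakk>
              \<Longrightarrow> add_mset y v \<in> inv_cone L U;
      w \<in> inv_cone L U\<rbrakk>
      \<Longrightarrow> add_mset x u \<notin> inv_multiples L w (U \<union> {w})"

definition involutive_set :: "'x division \<Rightarrow> 'x monom set \<Rightarrow> bool" where
  "involutive_set L U \<longleftrightarrow> cone U = inv_cone L U"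

definition is_completion :: "'x division \<Rightarrow> 'x monom set \<Rightarrow> 'x monom set \<Rightarrow> bool" where
  "is_completion L U V \<longleftrightarrow>
     finite V \<and> U \<subseteq> V \<and> involutive_set L V \<and> cone V = cone U"

definition finitely_generated :: "'x division \<Rightarrow> 'x monom set \<Rightarrow> bool" where
  "finitely_generated L U \<longleftrightarrow> (\<exists>V. is_completion L U V)"

definition is_minimal_completion :: "'x division \<Rightarrow> 'x monom set \<Rightarrow> 'x monom set \<Rightarrow> bool" where
  "is_minimal_completion L U W \<longleftrightarrow>
     is_completion L U W \<and> (\<forall>V. is_completion L U V \<longrightarrow> W \<subseteq> V)"

text \<open>
  The algorithm InvolutiveCompletion is a nondeterministic transition system whose state is the
  current set.  Its loop condition is that some product as below exists.
\<close>

definition open_prolongation ::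
    "'x division \<Rightarrow> 'x monom set \<Rightarrow> 'x monom \<Rightarrow> 'x \<Rightarrow> bool" where
  "open_prolongation L V u x \<longleftrightarrow>
     u \<in> V \<and> x \<in> nonmult_vars L u V \<and> (\<nexists>v. inv_dvd L V v (add_mset x u))"

definition loop_condition :: "'x division \<Rightarrow> 'x monom set \<Rightarrow> bool" where
  "loop_condition L V \<longleftrightarrow> (\<exists>u x. open_prolongation L V u x)"

text \<open>One pass through the loop body, with \<open>r\<close> the ordering chosen in this pass.\<close>

definition loop_body ::
    "'x division \<Rightarrow> 'x monom rel \<Rightarrow> 'x monom set \<Rightarrow> 'x monom set \<Rightarrow> bool" where
  "loop_body L r V V' \<longleftrightarrow>
     (\<exists>u x. open_prolongation L V u x \<and>
            (\<forall>u' x'. open_prolongation L V u' x' \<longrightarrow> (add_mset x u, add_mset x' u') \<in> r) \<and>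
            V' = V \<union> {add_mset x u})"

definition completion_step :: "'x division \<Rightarrow> 'x monom set \<Rightarrow> 'x monom set \<Rightarrow> bool" where
  "completion_step L V V' \<longleftrightarrow> (\<exists>r. admissible_ordering r \<and> loop_body L r V V')"

definition completion_returns :: "'x division \<Rightarrow> 'x monom set \<Rightarrow> 'x monom set \<Rightarrow> bool" where
  "completion_returns L U V \<longleftrightarrow> (completion_step L)\<^sup>*\<^sup>* U V \<and> \<not> loop_condition L V"

text \<open>
  Total correctness for all choices: no run is infinite, no run gets stuck inside the loop
  (whatever ordering is chosen there, the loop body can be executed), and \<open>W\<close> is returned by some
  run and is the only set returned by any run.
\<close>

definition completion_computes :: "'x division \<Rightarrow> 'x monom set \<Rightarrow> 'x monom set \<Rightarrow> bool" where
  "completion_computes L U W \<longleftrightarrow>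
     (\<nexists>V. V 0 = U \<and> (\<forall>i::nat. completion_step L (V i) (V (Suc i)))) \<and>
     (\<forall>V r. (completion_step L)\<^sup>*\<^sup>* U V \<and> loop_condition L V \<and> admissible_ordering r
        \<longrightarrow> (\<exists>V'. loop_body L r V V')) \<and>
     (\<forall>V. completion_returns L U V \<longleftrightarrow> V = W)"

end

theory Submission
  imports Defs "HOL-Library.Multiset_Order" "HOL-Library.Countable"
begin

text \<open>
  Fix an arbitrary completion \<open>T\<close> of \<open>U\<close>.  The heart of the matter is that no pass through the loop
  ever leaves \<open>T\<close>: if \<open>V \<subseteq> T\<close> is the current set, then the chosen product \<open>u \<cdot> x\<close> lies in \<open>T\<close>
  (\<open>lowest_prolongation_in_completion\<close>).  Indeed \<open>u \<cdot> x\<close> has an involutive divisor \<open>w\<close> in the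
  involutive set \<open>T\<close>.  If \<open>w \<noteq> u \<cdot> x\<close>, then \<open>w\<close> is a proper divisor of \<open>u \<cdot> x\<close>, and since
  \<open>u \<cdot> x\<close> is lowest, all nonmultiplicative products properly dividing it already lie in
  \<open>C\<^sub>L(V)\<close>.  Continuity turns this into \<open>w \<in> C\<^sub>L(V)\<close> (\<open>inv_cone_local\<close>), and then constructivity
  says that \<open>w\<close> cannot be an involutive divisor of \<open>u \<cdot> x\<close> in \<open>V \<union> {w}\<close>, let alone in the larger
  set \<open>T\<close>.

  Every pass adds a new monomial, so all runs stay in the finite set \<open>T\<close> and terminate.  When the
  loop stops, the same local criterion shows that the set is involutive.  The returned set
  is thus a completion contained in every completion.  This determines it, so that all
  runs return the same set.
\<close>

section \<open>Cones of a continuous division\<close>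

lemma in_cone_iff: "w \<in> cone V \<longleftrightarrow> (\<exists>v\<in>V. v \<subseteq># w)"
  by (auto simp: cone_def image_iff mset_subset_eq_exists_conv)

lemma in_inv_cone_iff: "w \<in> inv_cone L V \<longleftrightarrow> (\<exists>v. inv_dvd L V v w)"
  by (auto simp: inv_cone_def inv_dvd_def)

lemma inv_dvd_imp_subseteq: "inv_dvd L V v w \<Longrightarrow> v \<subseteq># w"
  by (auto simp: inv_dvd_def inv_multiples_def)

lemma cone_mono: "V \<subseteq> T \<Longrightarrow> cone V \<subseteq> cone T"
  by (auto simp: cone_def)

lemma inv_cone_subset_cone: "inv_cone L V \<subseteq> cone V"
  by (auto simp: inv_cone_def cone_def inv_multiples_def)

context involutive_division
begin

lemma inv_dvd_refl:
  assumes "finite V" "v \<in> V"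
  shows "inv_dvd L V v v"
proof -
  have "{#} \<in> L v V"
    using submonoid[OF assms] by (simp add: submonoid_monom_def)
  then show ?thesis
    using assms(2) by (force simp: inv_dvd_def inv_multiples_def)
qed

lemma inv_multiples_antimono:
  assumes "finite T" "V \<subseteq> T" "v \<in> V"
  shows "inv_multiples L v T \<subseteq> inv_multiples L v V"
  using filter_axiom[OF assms] unfolding inv_multiples_def by (rule image_mono)

lemma nonmult_var_if_notin:
  assumes "finite V" "v \<in> V" "t \<notin> L v V"
  obtains x where "x \<in># t" "x \<in> nonmult_vars L v V"
proof -
  have mon: "submonoid_monom (L v V)"
    by (rule submonoid[OF assms(1,2)])
  have "(\<forall>x\<in>#s. {#x#} \<in> L v V) \<longrightarrow> s \<in> L v V" for s
  proof (induction s)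
    case empty
    show ?case using mon by (simp add: submonoid_monom_def)
  next
    case (add x s)
    show ?case
    proof
      assume "\<forall>y\<in>#add_mset x s. {#y#} \<in> L v V"
      then have "{#x#} \<in> L v V" "s \<in> L v V"
        using add.IH by auto
      then have "{#x#} + s \<in> L v V"
        using mon unfolding submonoid_monom_def by blast
      then show "add_mset x s \<in> L v V"
        by simp
    qed
  qed
  with assms(3) obtain x where "x \<in># t" "{#x#} \<notin> L v V"
    by blast
  then show thesis
    by (intro that[of x]) (simp_all add: nonmult_vars_def mult_vars_def)
qed

end

context continuous_division
begin

text \<open>
  Start from any divisor \<open>u \<in> V\<close> of \<open>w\<close>.  As long as the current divisor is not involutive, it has a
  nonmultiplicative product dividing \<open>w\<close>, and an involutive divisor of that product is again an
  element of \<open>V\<close> dividing \<open>w\<close>.  By continuity this walk never repeats an element, so it ends, at an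
  involutive divisor of \<open>w\<close>.
\<close>

lemma inv_cone_local:
  assumes fin: "finite V" and w: "w \<in> cone V"
    and prolong: "\<And>v y. \<lbrakk>v \<in> V; y \<in> nonmult_vars L v V; add_mset y v \<subseteq># w\<rbrakk>
                    \<Longrightarrow> add_mset y v \<in> inv_cone L V"
  shows "w \<in> inv_cone L V"
proof (rule ccontr)
  assume notin: "w \<notin> inv_cone L V"
  define D where "D = {v \<in> V. v \<subseteq># w}"
  define nxt where "nxt v v' \<longleftrightarrow> v' \<in> D \<and>
    (\<exists>x\<in>nonmult_vars L v V. inv_dvd L V v' (add_mset x v))" for v v'
  have "\<exists>v'. nxt v v'" if "v \<in> D" for v
  proof -
    from that have v: "v \<in> V" "v \<subseteq># w"
      by (auto simp: D_def)
    then obtain t where t: "w = v + t"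
      by (auto simp: mset_subset_eq_exists_conv)
    have "t \<notin> L v V"
      using notin v(1) t by (auto simp: in_inv_cone_iff inv_dvd_def inv_multiples_def)
    then obtain x where x: "x \<in># t" "x \<in> nonmult_vars L v V"
      using nonmult_var_if_notin fin v(1) by blast
    from x(1) have dvd: "add_mset x v \<subseteq># w"
      by (auto simp: t dest!: multi_member_split)
    then obtain v' where v': "inv_dvd L V v' (add_mset x v)"
      using prolong v(1) x(2) by (auto simp: in_inv_cone_iff)
    then have "v' \<in> D"
      using dvd inv_dvd_imp_subseteq[OF v'] subset_mset.order_trans
      by (auto simp: D_def inv_dvd_def)
    then show ?thesis
      using v' x(2) by (auto simp: nxt_def)
  qed
  then obtain f where f: "\<And>v. v \<in> D \<Longrightarrow> nxt v (f v)"
    by metis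
  obtain u where u: "u \<in> D"
    using w by (auto simp: in_cone_iff D_def)
  define s where "s i = (f ^^ i) u" for i
  have s_D: "s i \<in> D" for i
    by (induction i) (use u f nxt_def in \<open>auto simp: s_def\<close>)
  have s_step: "nxt (s i) (s (Suc i))" for i
    using f[OF s_D[of i]] by (simp add: s_def)
  define us where "us = map s [0..<Suc (card V)]"
  have sub: "set us \<subseteq> V"
    using s_D by (auto simp: us_def D_def)
  have "distinct us"
  proof (rule continuous[OF fin sub])
    fix i assume "Suc i < length us"
    then have "us ! i = s i" "us ! Suc i = s (Suc i)"
      by (simp_all add: us_def nth_append del: upt_Suc)
    then show "\<exists>x\<in>nonmult_vars L (us ! i) V. inv_dvd L V (us ! Suc i) (add_mset x (us ! i))"
      using s_step[of i] by (simp add: nxt_def)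
  qed
  then have "card (set us) = Suc (card V)"
    by (simp only: distinct_card) (simp add: us_def)
  then show False
    using card_mono[OF fin sub] by simp
qed

lemma involutive_if_not_loop_condition:
  assumes "finite V" "\<not> loop_condition L V"
  shows "involutive_set L V"
proof -
  have "cone V \<subseteq> inv_cone L V"
    using inv_cone_local[OF assms(1)] assms(2)
    by (auto simp: loop_condition_def open_prolongation_def in_inv_cone_iff)
  then show ?thesis
    using inv_cone_subset_cone by (auto simp: involutive_set_def)
qed

end

section \<open>Admissible orderings\<close>

lemma admissible_subset_less:
  assumes "admissible_ordering r" "s \<subset># t"
  shows "(t, s) \<notin> r"
proof
  assume ts: "(t, s) \<in> r"
  obtain d where d: "t = s + d"
    using assms(2) by (auto simp: subset_mset.less_le mset_subset_eq_exists_conv)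
  have "({#} + s, d + s) \<in> r"
    using assms(1) unfolding admissible_ordering_def by blast
  then have "(s, t) \<in> r"
    by (simp add: d add.commute)
  moreover have "antisym r"
    using assms(1)
    by (simp add: admissible_ordering_def linear_order_on_def partial_order_on_def)
  ultimately show False
    using ts assms(2) by (auto dest: antisymD)
qed

text \<open>
  Without an admissible ordering the loop body could never be executed.  Numbering the variables
  makes the Dershowitz-Manna ordering of multisets one: it is total when the numbers are
  totally ordered, compatible with sums, and has the empty multiset as least element.
\<close>

lemma admissible_ordering_exists: "\<exists>r :: 'x::finite monom rel. admissible_ordering r"
proof -
  define f :: "'x monom \<Rightarrow> nat multiset" where "f = image_mset to_nat"
  have inj: "inj f"
    unfolding f_def by (rule multiset.inj_map) simp
  define r where "r = {(s, t). f s \<le> f t}"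
  have "refl r" "trans r" "total r"
    by (auto simp: r_def refl_on_def trans_def total_on_def)
  moreover have "antisym r"
    using inj by (auto simp: r_def antisym_def dest: injD)
  ultimately have "linear_order r"
    by (simp add: linear_order_on_def partial_order_on_def preorder_on_def)
  then have "admissible_ordering r"
    by (auto simp: admissible_ordering_def r_def f_def)
  then show ?thesis ..
qed

lemma finite_linear_order_min:
  assumes "linear_order r" "finite A" "A \<noteq> {}"
  shows "\<exists>a\<in>A. \<forall>b\<in>A. (a, b) \<in> r"
  using assms(2,3)
proof (induction A rule: finite_ne_induct)
  case (singleton a)
  then show ?case
    using assms(1)
    by (auto simp: linear_order_on_def partial_order_on_def preorder_on_def refl_on_def)
next
  case (insert b A)
  then obtain a where a: "a \<in> A" "\<forall>c\<in>A. (a, c) \<in> r"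
    by auto
  have r: "refl r" "trans r" "total r"
    using assms(1)
    by (auto simp: linear_order_on_def partial_order_on_def preorder_on_def)
  have "(b, b) \<in> r"
    using r(1) by (auto dest: refl_onD)
  moreover have "(a, b) \<in> r \<or> (b, a) \<in> r"
    using r(3) insert.hyps(3) a(1) unfolding total_on_def by (cases "a = b") auto
  ultimately show ?case
    using a r(2) by (auto dest: transD)
qed

lemma loop_body_executable:
  fixes L :: "'x::finite division"
  assumes "admissible_ordering r" "finite V" "loop_condition L V"
  shows "\<exists>V'. loop_body L r V V'"
proof -
  define P where "P = {add_mset x u | u x. open_prolongation L V u x}"
  have "P \<subseteq> (\<lambda>(u, x). add_mset x u) ` (V \<times> UNIV)"
    by (auto simp: P_def open_prolongation_def)
  then have "finite P"
    using assms(2) by (auto intro: finite_subset)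
  moreover have "P \<noteq> {}"
    using assms(3) by (auto simp: P_def loop_condition_def)
  moreover have "linear_order r"
    using assms(1) by (simp add: admissible_ordering_def)
  ultimately obtain p where p: "p \<in> P" and least: "\<forall>q\<in>P. (p, q) \<in> r"
    using finite_linear_order_min[of r P] by blast
  then obtain u x where "p = add_mset x u" "open_prolongation L V u x"
    by (auto simp: P_def)
  moreover have "(p, add_mset y v) \<in> r" if "open_prolongation L V v y" for v y
    using least that by (auto simp: P_def)
  ultimately show ?thesis
    unfolding loop_body_def by blast
qed

section \<open>Runs of the algorithm stay inside every completion\<close>

context constructive_division
begin

text \<open>
  Lowest products enter only through the fact that every proper divisor of the form \<open>v \<cdot> y\<close> is
  already covered, because an admissible ordering refines divisibility.  This is why the ordering
  may be changed from pass to pass.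
\<close>

lemma lowest_prolongation_in_completion:
  assumes r: "admissible_ordering r"
    and T: "finite T" "involutive_set L T" and V: "V \<subseteq> T" "cone T \<subseteq> cone V"
    and op: "open_prolongation L V u x"
    and lowest: "\<And>v y. open_prolongation L V v y \<Longrightarrow> (add_mset x u, add_mset y v) \<in> r"
  shows "add_mset x u \<in> T"
proof (rule ccontr)
  assume notin: "add_mset x u \<notin> T"
  have finV: "finite V"
    using T(1) V(1) by (rule finite_subset[rotated])
  from op have u: "u \<in> V" and x: "x \<in> nonmult_vars L u V"
    and no_div: "\<nexists>v. inv_dvd L V v (add_mset x u)"
    by (auto simp: open_prolongation_def)
  have below: "add_mset y v \<in> inv_cone L V"
    if "v \<in> V" "y \<in> nonmult_vars L v V" "add_mset y v \<subset># add_mset x u" for v y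
  proof (rule ccontr)
    assume "add_mset y v \<notin> inv_cone L V"
    with that(1,2) have "open_prolongation L V v y"
      by (simp add: open_prolongation_def in_inv_cone_iff)
    from lowest[OF this] admissible_subset_less[OF r that(3)] show False by simp
  qed
  have "add_mset x u \<in> cone T"
    using u V(1) by (auto simp: in_cone_iff intro!: bexI[of _ u])
  then obtain w where w: "inv_dvd L T w (add_mset x u)"
    using T(2) by (auto simp: involutive_set_def in_inv_cone_iff)
  then have wT: "w \<in> T"
    by (simp add: inv_dvd_def)
  then have w_less: "w \<subset># add_mset x u"
    using inv_dvd_imp_subseteq[OF w] notin by (auto simp: subset_mset.less_le)
  have "w \<in> inv_cone L V"
  proof (rule inv_cone_local[OF finV])
    have "w \<in> cone T"
      using wT by (auto simp: in_cone_iff)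
    then show "w \<in> cone V"
      using V(2) by auto
  next
    fix v y
    assume "v \<in> V" "y \<in> nonmult_vars L v V" "add_mset y v \<subseteq># w"
    then show "add_mset y v \<in> inv_cone L V"
      by (intro below subset_mset.le_less_trans[OF _ w_less])
  qed
  then have "add_mset x u \<notin> inv_multiples L w (V \<union> {w})"
    using constructive[OF finV u x no_div below] by blast
  moreover have "inv_multiples L w T \<subseteq> inv_multiples L w (V \<union> {w})"
    using inv_multiples_antimono[OF T(1), of "V \<union> {w}" w] V(1) wT by auto
  ultimately show False
    using w by (auto simp: inv_dvd_def)
qed

lemma completion_step_in_completion:
  assumes T: "is_completion L U T" and V: "U \<subseteq> V" "V \<subseteq> T" and step: "completion_step L V V'"
  shows "V \<subset> V' \<and> V' \<subseteq> T"
proof -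
  from step obtain r u x where r: "admissible_ordering r" and op: "open_prolongation L V u x"
    and lowest: "\<And>v y. open_prolongation L V v y \<Longrightarrow> (add_mset x u, add_mset y v) \<in> r"
    and V': "V' = V \<union> {add_mset x u}"
    unfolding completion_step_def loop_body_def by blast
  from T have fin: "finite T" and inv: "involutive_set L T" and "cone T = cone U"
    by (auto simp: is_completion_def)
  then have "cone T \<subseteq> cone V"
    using cone_mono[OF V(1)] by simp
  then have "add_mset x u \<in> T"
    using lowest_prolongation_in_completion[OF r fin inv V(2) _ op lowest] by simp
  \<comment> \<open>An element of \<open>V\<close> is its own involutive divisor.\<close>
  moreover have "add_mset x u \<notin> V"
    using op inv_dvd_refl[of V "add_mset x u"] finite_subset[OF V(2) fin]
    by (auto simp: open_prolongation_def)
  ultimately show ?thesis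
    using V V' by auto
qed

lemma reachable_in_completion:
  assumes "(completion_step L)\<^sup>*\<^sup>* U V" "is_completion L U T"
  shows "U \<subseteq> V \<and> V \<subseteq> T"
  using assms(1)
proof (induction rule: rtranclp_induct)
  case base
  show ?case using assms(2) by (auto simp: is_completion_def)
next
  case (step V V')
  then show ?case
    using completion_step_in_completion[OF assms(2), of V V'] by auto
qed

lemma returned_minimal_completion:
  assumes "finitely_generated L U" "completion_returns L U V"
  shows "is_minimal_completion L U V"
proof -
  from assms(2) have run: "(completion_step L)\<^sup>*\<^sup>* U V" and stop: "\<not> loop_condition L V"
    by (auto simp: completion_returns_def)
  obtain T where T: "is_completion L U T"
    using assms(1) by (auto simp: finitely_generated_def)
  have sub: "U \<subseteq> V" "V \<subseteq> T"
    using reachable_in_completion[OF run T] by auto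
  have fin: "finite V"
    using T sub(2) by (auto simp: is_completion_def intro: finite_subset)
  have "cone V = cone U"
    using cone_mono[OF sub(1)] cone_mono[OF sub(2)] T by (auto simp: is_completion_def)
  then have "is_completion L U V"
    using fin sub(1) involutive_if_not_loop_condition[OF fin stop]
    by (simp add: is_completion_def)
  then show ?thesis
    using reachable_in_completion[OF run] by (auto simp: is_minimal_completion_def)
qed

lemma no_infinite_run:
  assumes "finitely_generated L U"
  shows "\<nexists>V. V 0 = U \<and> (\<forall>i::nat. completion_step L (V i) (V (Suc i)))"
proof
  assume "\<exists>V. V 0 = U \<and> (\<forall>i::nat. completion_step L (V i) (V (Suc i)))"
  then obtain V where V0: "V 0 = U" and step: "\<And>i::nat. completion_step L (V i) (V (Suc i))"
    by blast
  obtain T where T: "is_completion L U T"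
    using assms by (auto simp: finitely_generated_def)
  then have finT: "finite T"
    by (simp add: is_completion_def)
  have "(completion_step L)\<^sup>*\<^sup>* U (V i)" for i
    by (induction i) (auto simp: V0 intro: rtranclp.rtrancl_into_rtrancl step)
  then have bounds: "U \<subseteq> V i \<and> V i \<subseteq> T" for i
    using reachable_in_completion T by blast
  then have grow: "card (V i) < card (V (Suc i))" for i
    using completion_step_in_completion[OF T _ _ step] finT
    by (meson finite_subset psubset_card_mono)
  have "i \<le> card (V i)" for i
  proof (induction i)
    case (Suc i)
    then show ?case using grow[of i] by linarith
  qed simp
  from this[of "Suc (card T)"] show False
    using card_mono[OF finT, of "V (Suc (card T))"] bounds by fastforce
qed

lemma loop_never_stuck:
  assumes "finitely_generated L U" "(completion_step L)\<^sup>*\<^sup>* U V" "loop_condition L V"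
    "admissible_ordering r"
  shows "\<exists>V'. loop_body L r V V'"
proof -
  obtain T where T: "is_completion L U T"
    using assms(1) by (auto simp: finitely_generated_def)
  then have "finite V"
    using reachable_in_completion[OF assms(2) T]
    by (auto simp: is_completion_def intro: finite_subset)
  then show ?thesis
    using loop_body_executable assms(3,4) by blast
qed

text \<open>
  With one admissible ordering used in every pass, a run that never returned could be prolonged
  forever.
\<close>

lemma completion_returns_exists:
  assumes "finitely_generated L U"
  shows "\<exists>V. completion_returns L U V"
proof (rule ccontr)
  assume none: "\<nexists>V. completion_returns L U V"
  obtain r :: "'a monom rel" where r: "admissible_ordering r"
    using admissible_ordering_exists by blast
  define reach where "reach V \<longleftrightarrow> (completion_step L)\<^sup>*\<^sup>* U V" for V
  have progress: "\<exists>V'. reach V' \<and> completion_step L V V'" if V: "reach V" for V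
  proof -
    have "loop_condition L V"
      using V none by (auto simp: completion_returns_def reach_def)
    then obtain V' where "loop_body L r V V'"
      using loop_never_stuck[OF assms _ _ r] V unfolding reach_def by blast
    then have "completion_step L V V'"
      using r by (auto simp: completion_step_def)
    then show ?thesis
      using V by (auto simp: reach_def intro: rtranclp.rtrancl_into_rtrancl)
  qed
  have "\<exists>V. \<forall>i::nat. (reach (V i) \<and> (i = 0 \<longrightarrow> V i = U)) \<and> completion_step L (V i) (V (Suc i))"
  proof (rule dependent_nat_choice)
    show "\<exists>V. reach V \<and> (0 = (0::nat) \<longrightarrow> V = U)"
      by (auto simp: reach_def)
  next
    fix V and i :: nat
    assume "reach V \<and> (i = 0 \<longrightarrow> V = U)"
    then show "\<exists>V'. (reach V' \<and> (Suc i = 0 \<longrightarrow> V' = U)) \<and> completion_step L V V'"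
      using progress by blast
  qed
  then show False
    using no_infinite_run[OF assms] by blast
qed

end

section \<open>The algorithm computes the minimal completion\<close>

theorem theorem4p1:
  fixes L :: "'x::finite division" and U :: "'x monom set"
  assumes "constructive_division L"
    and "finite U"
    and "finitely_generated L U"
  shows "(\<exists>!W. is_minimal_completion L U W) \<and>
    (\<forall>W. is_minimal_completion L U W \<longrightarrow> completion_computes L U W)"
proof -
  interpret constructive_division L
    by (rule assms(1))
  obtain V where V: "completion_returns L U V"
    using completion_returns_exists[OF assms(3)] by blast
  have unique: "W = W'" if "is_minimal_completion L U W" "is_minimal_completion L U W'" for W W'
    using that by (auto simp: is_minimal_completion_def)
  have minV: "is_minimal_completion L U V"
    by (rule returned_minimal_completion[OF assms(3) V])
  have "completion_computes L U W" if W: "is_minimal_completion L U W" for W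
    unfolding completion_computes_def
  proof (intro conjI allI impI)
    show "\<nexists>V. V 0 = U \<and> (\<forall>i::nat. completion_step L (V i) (V (Suc i)))"
      by (rule no_infinite_run[OF assms(3)])
  next
    fix V' :: "'x monom set" and r :: "'x monom rel"
    assume "(completion_step L)\<^sup>*\<^sup>* U V' \<and> loop_condition L V' \<and> admissible_ordering r"
    then show "\<exists>V''. loop_body L r V' V''"
      using loop_never_stuck[OF assms(3)] by blast
  next
    fix V'
    show "completion_returns L U V' \<longleftrightarrow> V' = W"
      using unique[OF minV W] V unique[OF _ W] returned_minimal_completion[OF assms(3)] by blast
  qed
  with minV unique show ?thesis
    by blast
qed

end
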